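(* Let $g:\mathbb{R}^n\to\mathbb{R}$ be tangentially convex and directionally differentiable at $\bar x\in\mathbb{R}^n$, and let $\varphi:\mathbb{R}\to\mathbb{R}$ be continuously differentiable in a neighbourhood of $g(\bar x)$. Then $$(\varphi\circ g)'(\bar x;v)=\varphi'(g(\bar x))\,g'(\bar x;v)\qquad\text{for all }v\in\mathbb{R}^n.$$ If, in addition, $\varphi'(g(\bar x))\ge 0$, then $$\partial_T(\varphi\circ g)(\bar x)\subset\varphi'(g(\bar x))\,\partial_T g(\bar x).$$
   Context: For $h:\mathbb{R}^n\to\mathbb{R}\cup\{+\infty\}$ and $\bar x\in\operatorname{dom}h$, the directional derivative is $h'(\bar x;v):=\lim_{t\downarrow 0}\frac{h(\bar x+tv)-h(\bar x)}{t}$ whenever the limit exists. $h$ is tangentially convex at $\bar x$ if $h'(\bar x;v)$ exists and is finite for every $v\in\mathbb{R}^n$ and $v\mapsto h'(\bar x;v)$ is convex. The tangential subdifferential is $\partial_T h(\bar x):=\{\xi\in\mathbb{R}^n:\langle\xi,v\rangle\le h'(\bar x;v)\ \forall v\in\mathbb{R}^n\}$. *)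

theory Defs
  imports "HOL-Analysis.Analysis"
begin

(* Functions into the reals extended by +infinity are rendered with codomain ereal.
   The limit is taken in ereal, so infinite directional derivatives are admitted.
   The first conjunct is the requirement that the base point lie in the domain of h. *)
definition has_dir_deriv ::
    "('a::real_vector \<Rightarrow> ereal) \<Rightarrow> 'a \<Rightarrow> 'a \<Rightarrow> ereal \<Rightarrow> bool"
  where "has_dir_deriv h x v l \<longleftrightarrow>
    \<bar>h x\<bar> \<noteq> \<infinity> \<and>
    ((\<lambda>t::real. (h (x + t *\<^sub>R v) - h x) / ereal t) \<longlongrightarrow> l) (at_right 0)"

(* Unspecified when the limit does not exist. *)
definition dir_deriv :: "('a::real_vector \<Rightarrow> ereal) \<Rightarrow> 'a \<Rightarrow> 'a \<Rightarrow> ereal"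
  where "dir_deriv h x v = (THE l. has_dir_deriv h x v l)"

definition dir_differentiable_at :: "('a::real_vector \<Rightarrow> ereal) \<Rightarrow> 'a \<Rightarrow> bool"
  where "dir_differentiable_at h x \<longleftrightarrow> (\<forall>v. \<exists>l. has_dir_deriv h x v l)"

(* The projection real_of_ereal loses nothing here: the first conjunct makes every
   directional derivative finite. *)
definition tangentially_convex_at :: "('a::real_vector \<Rightarrow> ereal) \<Rightarrow> 'a \<Rightarrow> bool"
  where "tangentially_convex_at h x \<longleftrightarrow>
    (\<forall>v. \<exists>l. has_dir_deriv h x v l \<and> \<bar>l\<bar> \<noteq> \<infinity>) \<and>
    convex_on UNIV (\<lambda>v. real_of_ereal (dir_deriv h x v))"

(* Meaningful only where h is directionally differentiable. *)
definition tangential_subdifferential :: "('a::real_inner \<Rightarrow> ereal) \<Rightarrow> 'a \<Rightarrow> 'a set"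
  where "tangential_subdifferential h x = {\<xi>. \<forall>v. ereal (\<xi> \<bullet> v) \<le> dir_deriv h x v}"

lemma has_dir_deriv_unique:
  assumes "has_dir_deriv h x v l" and "has_dir_deriv h x v m"
  shows "l = m"
  using assms tendsto_unique[OF trivial_limit_at_right_real]
  unfolding has_dir_deriv_def by blast

lemma dir_deriv_eq: "has_dir_deriv h x v l \<Longrightarrow> dir_deriv h x v = l"
  unfolding dir_deriv_def by (blast intro: has_dir_deriv_unique)

lemma has_dir_deriv_ereal_iff:
  fixes f :: "'a::real_vector \<Rightarrow> real"
  shows "has_dir_deriv (\<lambda>y. ereal (f y)) x v (ereal d) \<longleftrightarrow>
    ((\<lambda>t. (f (x + t *\<^sub>R v) - f x) / t) \<longlongrightarrow> d) (at_right 0)"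
proof -
  have "\<forall>\<^sub>F t in at_right (0::real).
      (ereal (f (x + t *\<^sub>R v)) - ereal (f x)) / ereal t = ereal ((f (x + t *\<^sub>R v) - f x) / t)"
    using eventually_at_right_less[of "0::real"] by eventually_elim simp
  from tendsto_cong[OF this] show ?thesis
    unfolding has_dir_deriv_def by simp
qed

end

theory Submission
  imports Defs
begin

text \<open>
  The chain rule is the one-dimensional one, applied along the ray at \<open>x\<close> in direction \<open>v\<close>.
  If \<open>c = \<phi>' (g x)\<close> is positive, the inclusion follows by dividing by \<open>c\<close>. If \<open>c = 0\<close>, the
  left-hand side is \<open>{0}\<close>, so the inclusion amounts to the tangential subdifferential of \<open>g\<close>
  being nonempty: a finite convex function vanishing at \<open>0\<close> has a subgradient there, by
  separating \<open>0\<close> from its strict epigraph.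
\<close>

text \<open>The filter \<open>at_right 0\<close> is \<open>at 0 within {0<..}\<close>, so the limit
  over t > 0 is a derivative within a set, to which the library chain rule applies.\<close>

lemma has_dir_deriv_iff_has_field_derivative:
  fixes f :: "'a::real_vector \<Rightarrow> real"
  shows "has_dir_deriv (\<lambda>y. ereal (f y)) x v (ereal d) \<longleftrightarrow>
    ((\<lambda>t. f (x + t *\<^sub>R v)) has_field_derivative d) (at_right 0)"
  by (simp add: has_dir_deriv_ereal_iff has_field_derivative_iff)

text \<open>The inner derivative is one-sided, but the outer one is two-sided: along the ray,
  \<open>g\<close> may approach \<open>g x\<close> from above, from below, or while
  oscillating.\<close>

lemma has_dir_deriv_compose:
  fixes g :: "'a::real_vector \<Rightarrow> real"
  assumes "(\<phi> has_field_derivative c) (at (g x))"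
    and "has_dir_deriv (\<lambda>y. ereal (g y)) x v (ereal d)"
  shows "has_dir_deriv (\<lambda>y. ereal ((\<phi> \<circ> g) y)) x v (ereal (c * d))"
  using DERIV_chain[of \<phi> c "\<lambda>t. g (x + t *\<^sub>R v)" 0 d "{0<..}"] assms
  by (simp add: has_dir_deriv_iff_has_field_derivative o_def)

lemma dir_deriv_zero:
  fixes g :: "'a::real_vector \<Rightarrow> real"
  shows "dir_deriv (\<lambda>y. ereal (g y)) x 0 = 0"
proof -
  have "has_dir_deriv (\<lambda>y. ereal (g y)) x 0 (ereal 0)"
    by (simp add: has_dir_deriv_ereal_iff)
  then show ?thesis
    by (simp add: dir_deriv_eq zero_ereal_def)
qed

lemma convex_on_UNIV_subgradient_at_0:
  fixes p :: "'a::euclidean_space \<Rightarrow> real"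
  assumes "convex_on UNIV p" and "p 0 = 0"
  obtains \<xi> where "\<And>v. \<xi> \<bullet> v \<le> p v"
proof -
  \<comment> \<open>The strict inequality keeps the origin, which lies on the graph because
    \<open>p 0 = 0\<close>, outside \<open>E\<close>, as the separation requires.\<close>
  define E where "E = {z :: 'a \<times> real. p (fst z) < snd z}"
  have "convex E"
  proof (rule convexI)
    fix y z :: "'a \<times> real" and s t :: real
    assume E: "y \<in> E" "z \<in> E" and st: "0 \<le> s" "0 \<le> t" "s + t = 1"
    have "p (s *\<^sub>R fst y + t *\<^sub>R fst z) \<le> s * p (fst y) + t * p (fst z)"
      using assms(1) st by (simp add: convex_on_def)
    also have "\<dots> < s * snd y + t * snd z"
    \<comment> \<open>Strictness must come from a summand with positive weight: the second one if
      \<open>s = 0\<close> (then \<open>t = 1\<close>), otherwise the first.\<close>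
    proof (cases "s = 0")
      case True
      then show ?thesis using E st by (simp add: E_def)
    next
      case False
      then show ?thesis
        using E st by (intro add_less_le_mono mult_left_mono mult_strict_left_mono) (auto simp: E_def)
    qed
    finally show "s *\<^sub>R y + t *\<^sub>R z \<in> E"
      by (simp add: E_def)
  qed
  moreover have "0 \<notin> E"
    by (simp add: E_def assms)
  ultimately obtain z where z: "z \<noteq> 0" "\<forall>y\<in>E. 0 \<le> z \<bullet> y"
    using separating_hyperplane_set_0 by blast
  obtain a b where ab: "z = (a, b)"
    by (cases z)
  have ge: "0 \<le> a \<bullet> v + b * r" if "p v < r" for v r
    using bspec[OF z(2), of "(v, r)"] that ab by (simp add: E_def)
  \<comment> \<open>The hyperplane is not vertical: \<open>p\<close> is finite everywhere, so
    \<open>E\<close> has a point above \<open>- a\<close>. With \<open>b = 0\<close>, that point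
    would force \<open>a = 0\<close>, hence \<open>z = 0\<close>.\<close>
  have "b \<noteq> 0"
  proof
    assume "b = 0"
    then have "0 \<le> a \<bullet> (- a)"
      using ge[of "- a" "p (- a) + 1"] by simp
    then have "a \<bullet> a \<le> 0"
      by simp
    then have "a = 0"
      by (meson inner_gt_zero_iff not_less)
    with \<open>b = 0\<close> z(1) ab show False
      by (simp add: zero_prod_def)
  qed
  moreover have "0 \<le> b"
    using ge[of 0 1] assms(2) by simp
  ultimately have "0 < b"
    by simp
  \<comment> \<open>Dividing \<open>ge\<close> by \<open>b\<close> bounds the left-hand side by
    every \<open>r\<close> above \<open>p v\<close>; letting \<open>r\<close> decrease to
    \<open>p v\<close> gives the claim.\<close>
  have "(- a /\<^sub>R b) \<bullet> v \<le> p v" for v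
  proof (rule dense_ge)
    fix r assume "p v < r"
    then show "(- a /\<^sub>R b) \<bullet> v \<le> r"
      using ge[of v r] \<open>0 < b\<close> by (simp add: field_simps)
  qed
  then show ?thesis
    by (rule that)
qed

text \<open>Packages the derivatives as one real-valued function \<open>d\<close>, so that later
  computations take place in the reals rather than in \<open>ereal\<close>.\<close>

lemma tangentially_convex_atE:
  assumes "tangentially_convex_at h x"
  obtains d where "\<And>v. has_dir_deriv h x v (ereal (d v))" and "convex_on UNIV d"
proof
  show "convex_on UNIV (\<lambda>v. real_of_ereal (dir_deriv h x v))"
    using assms by (simp only: tangentially_convex_at_def)
  fix v
  have "\<exists>l. has_dir_deriv h x v l \<and> \<bar>l\<bar> \<noteq> \<infinity>"
    using assms by (simp only: tangentially_convex_at_def)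
  then obtain l where l: "has_dir_deriv h x v l" "\<bar>l\<bar> \<noteq> \<infinity>"
    by (elim exE conjE)
  show "has_dir_deriv h x v (ereal (real_of_ereal (dir_deriv h x v)))"
    using l(1) by (simp only: dir_deriv_eq[OF l(1)] ereal_real'[OF l(2)])
qed

lemma tangential_subdifferential_nonempty:
  fixes g :: "'a::euclidean_space \<Rightarrow> real"
  assumes "tangentially_convex_at (\<lambda>y. ereal (g y)) x"
  shows "tangential_subdifferential (\<lambda>y. ereal (g y)) x \<noteq> {}"
proof -
  obtain d where d: "\<And>v. has_dir_deriv (\<lambda>y. ereal (g y)) x v (ereal (d v))"
    and "convex_on UNIV d"
    using tangentially_convex_atE[OF assms] by blast
  note G = dir_deriv_eq[OF d]
  have "d 0 = 0"
    using G[of 0] by (simp add: dir_deriv_zero)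
  with \<open>convex_on UNIV d\<close> obtain \<xi> where "\<And>v. \<xi> \<bullet> v \<le> d v"
    using convex_on_UNIV_subgradient_at_0 by blast
  then have "\<xi> \<in> tangential_subdifferential (\<lambda>y. ereal (g y)) x"
    by (simp add: tangential_subdifferential_def G)
  then show ?thesis
    by blast
qed

theorem proposition1:
  fixes g :: "real ^ 'n \<Rightarrow> real"
    and \<phi> :: "real \<Rightarrow> real"
    and x :: "real ^ 'n"
    and U :: "real set"
  assumes "tangentially_convex_at (\<lambda>y. ereal (g y)) x"
    and "dir_differentiable_at (\<lambda>y. ereal (g y)) x"
    and "open U" and "g x \<in> U" and "\<phi> C1_differentiable_on U"
  shows "(\<forall>v. has_dir_deriv (\<lambda>y. ereal ((\<phi> \<circ> g) y)) x v
              (ereal (deriv \<phi> (g x)) * dir_deriv (\<lambda>y. ereal (g y)) x v)) \<and>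
         (deriv \<phi> (g x) \<ge> 0 \<longrightarrow>
           tangential_subdifferential (\<lambda>y. ereal ((\<phi> \<circ> g) y)) x
             \<subseteq> (\<lambda>\<xi>. deriv \<phi> (g x) *\<^sub>R \<xi>) ` tangential_subdifferential (\<lambda>y. ereal (g y)) x)"
proof -
  define c where "c = deriv \<phi> (g x)"
  let ?G = "\<lambda>y. ereal (g y)"
  let ?H = "\<lambda>y. ereal ((\<phi> \<circ> g) y)"
  have c: "(\<phi> has_field_derivative c) (at (g x))"
    using assms(4,5) unfolding c_def
    by (metis C1_differentiable_on_def DERIV_imp_deriv has_real_derivative_iff_has_vector_derivative)
  obtain d where d: "\<And>v. has_dir_deriv ?G x v (ereal (d v))"
    using tangentially_convex_atE[OF assms(1)] by blast
  have G: "dir_deriv ?G x v = ereal (d v)" for v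
    by (rule dir_deriv_eq[OF d])
  have chain: "has_dir_deriv ?H x v (ereal (c * d v))" for v
    using has_dir_deriv_compose[OF c d] .
  have H: "dir_deriv ?H x v = ereal (c * d v)" for v
    by (rule dir_deriv_eq[OF chain])
  have "\<xi> \<in> (\<lambda>\<xi>. c *\<^sub>R \<xi>) ` tangential_subdifferential ?G x"
    if "0 \<le> c" and "\<xi> \<in> tangential_subdifferential ?H x" for \<xi>
  proof -
    have \<xi>: "\<xi> \<bullet> v \<le> c * d v" for v
      using that(2) by (simp add: tangential_subdifferential_def H[unfolded o_def])
    show ?thesis
    proof (cases "c = 0")
      case True
      \<comment> \<open>The bound is now zero in every direction; the direction \<open>\<xi>\<close>
        itself is the decisive test.\<close>
      then have "\<xi> \<bullet> \<xi> \<le> 0"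
        using \<xi>[of \<xi>] by simp
      then have "\<xi> = 0"
        by (meson inner_gt_zero_iff not_less)
      \<comment> \<open>Scaling by \<open>c = 0\<close> sends every subgradient of \<open>g\<close>
        to 0, so 0 lies in the image as soon as one subgradient exists.\<close>
      then show ?thesis
        using True tangential_subdifferential_nonempty[OF assms(1)] by auto
    next
      case False
      with that(1) have "0 < c"
        by simp
      then have "\<xi> /\<^sub>R c \<in> tangential_subdifferential ?G x"
        using \<xi> by (simp add: tangential_subdifferential_def G field_simps)
      then show ?thesis
        using False by (intro image_eqI[where x = "\<xi> /\<^sub>R c"]) simp_all
    qed
  qed
  with chain show ?thesis
    by (auto simp: G c_def)
qed

end
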